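(* Let $\mathcal{G}=(\mathcal{V},\mathcal{E})$ be a quasi-strongly connected directed graph on $n$ nodes, let $\{R_{ij}\}_{(i,j)\in\mathcal{E}}$ be a collection of matrices in $O(d)$, and suppose there are $\delta_1,\delta_2>0$ such that the edge weights satisfy $\delta_1\le a_{ij}\le\delta_2$ for all $(i,j)\in\mathcal{E}$. Let $L_{\text{dir}}=\text{diag}(A1_n)\otimes I_d-W$. Then: (1) The dynamical system $\dot x(t)=-L_{\text{dir}}x(t)$, $x(t)\in\mathbb{R}^{nd}$, is critically stable. (2) $\|P\|_2$ is an upper bound for $\|L_{\text{dir}}\|_2$, where $P=\text{diag}(A1_n)+A$. (3) If in addition $\mathcal{G}$ is strongly connected, then (a) the matrix $L_{\text{dir}}$ has no purely imaginary eigenvalues; (b) there is $\epsilon=\epsilon(n,d,\delta_1,\delta_2)>0$ (depending only on $n,d,\delta_1,\delta_2$) such that for $\epsilon_3\in(0,\epsilon)$ the eigenvalues of the matrix $I-\epsilon_3L_{\text{dir}}$ are contained in the closed unit disc, and if there is an eigenvalue on the boundary of the disc, it is equal to $1$ and its algebraic and geometric multiplicities are equal.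
   Context: $\mathcal{G}=(\mathcal{V},\mathcal{E})$ is a directed graph with $\mathcal{V}=\{1,\ldots,n\}$, $\mathcal{E}\subset\mathcal{V}\times\mathcal{V}$. A directed path is a finite sequence of unique nodes in which each consecutive pair is an edge in $\mathcal{E}$. $\mathcal{G}$ is quasi-strongly connected (QSC) if it contains a center, i.e. a node to which there is a directed path from any other node; it is strongly connected if for all pairs $(i,j)$ there is a directed path from $i$ to $j$. $A=[a_{ij}]$ is the weighted adjacency matrix, with $a_{ij}>0$ for $(i,j)\in\mathcal{E}$ and $a_{ij}=0$ otherwise; $1_n$ is the all-ones vector. $O(d)$ is the group of orthogonal $d\times d$ real matrices. $W$ is the $nd\times nd$ block matrix whose $(i,j)$-th $d\times d$ block is $a_{ij}R_{ij}$ if $(i,j)\in\mathcal{E}$ and $0$ otherwise. $\|\cdot\|_2$ is the spectral norm. "Critically stable" is used in the sense that the system matrix $-L_{\text{dir}}$ has no eigenvalue with positive real part and no Jordan block of dimension larger than one corresponding to an eigenvalue on the imaginary axis. "Purely imaginary" means nonzero with zero real part. *)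

theory Defs
  imports
    "Jordan_Normal_Form.Jordan_Normal_Form_Existence"
    "Jordan_Normal_Form.Jordan_Normal_Form_Uniqueness"
    "Jordan_Normal_Form.Spectral_Radius"
    "Graph_Theory.Pair_Digraph"
    "Graph_Theory.Digraph_Component"
    "Graph_Theory.Vertex_Walk"
    "HOL-Analysis.L2_Norm"
begin

text \<open>
  Digraphs are those of \<open>Graph_Theory\<close> without parallel arcs (loops are allowed). A directed path is
  a \<^const>\<open>vpath\<close>, that is, a nonempty list of distinct vertices whose consecutive pairs are arcs.
\<close>

definition quasi_strongly_connected :: "('a, 'b) pre_digraph \<Rightarrow> bool" where
  "quasi_strongly_connected G \<longleftrightarrow>
     (\<exists>c\<in>verts G. \<forall>u\<in>verts G - {c}. \<exists>p. vpath p G \<and> hd p = u \<and> last p = c)"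

text \<open>
  Strong connectivity is the library's \<^const>\<open>strongly_connected\<close>, which is phrased with
  reachability; it amounts to the existence of directed paths between all pairs of nodes.
\<close>

lemma strongly_connected_iff_vpath:
  assumes "wf_digraph G"
  shows "strongly_connected G \<longleftrightarrow> verts G \<noteq> {} \<and>
    (\<forall>u\<in>verts G. \<forall>v\<in>verts G. \<exists>p. vpath p G \<and> hd p = u \<and> last p = v)"
proof -
  interpret wf_digraph G by fact
  show ?thesis by (simp add: strongly_connected_def reachable_vpath_conv)
qed

definition orthogonal_group :: "nat \<Rightarrow> real mat set" where
  "orthogonal_group d = {Q \<in> carrier_mat d d. transpose_mat Q * Q = 1\<^sub>m d}"

text \<open>The nodes are \<open>0, \<dots>, n - 1\<close>, to match the indexing of matrices.\<close>

definition weighted_network ::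
  "nat \<Rightarrow> nat \<Rightarrow> real \<Rightarrow> real \<Rightarrow> nat pair_pre_digraph \<Rightarrow> (nat \<Rightarrow> nat \<Rightarrow> real) \<Rightarrow> (nat \<Rightarrow> nat \<Rightarrow> real mat) \<Rightarrow> bool"
where
  "weighted_network n d \<delta>\<^sub>1 \<delta>\<^sub>2 G a R \<longleftrightarrow>
     pair_wf_digraph G \<and> pverts G = {0..<n} \<and>
     (\<forall>(i, j)\<in>parcs G. R i j \<in> orthogonal_group d \<and> \<delta>\<^sub>1 \<le> a i j \<and> a i j \<le> \<delta>\<^sub>2)"

text \<open>The values of \<open>a\<close> and \<open>R\<close> outside the arc set are never used.\<close>

definition adjacency_mat :: "nat \<Rightarrow> nat pair_pre_digraph \<Rightarrow> (nat \<Rightarrow> nat \<Rightarrow> real) \<Rightarrow> real mat" where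
  "adjacency_mat n G a = mat n n (\<lambda>(i, j). if (i, j) \<in> parcs G then a i j else 0)"

definition row_sum_mat :: "real mat \<Rightarrow> real mat" where
  "row_sum_mat A = mat_diag (dim_row A) (\<lambda>i. (A *\<^sub>v vec (dim_col A) (\<lambda>_. 1)) $ i)"

definition kronecker_mat :: "real mat \<Rightarrow> real mat \<Rightarrow> real mat" where
  "kronecker_mat A B = mat (dim_row A * dim_row B) (dim_col A * dim_col B)
     (\<lambda>(r, s). A $$ (r div dim_row B, s div dim_col B) * B $$ (r mod dim_row B, s mod dim_col B))"

definition block_mat :: "nat \<Rightarrow> nat \<Rightarrow> (nat \<Rightarrow> nat \<Rightarrow> real mat) \<Rightarrow> real mat" where
  "block_mat n d B = mat (n * d) (n * d) (\<lambda>(r, s). B (r div d) (s div d) $$ (r mod d, s mod d))"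

definition W_mat ::
  "nat \<Rightarrow> nat \<Rightarrow> nat pair_pre_digraph \<Rightarrow> (nat \<Rightarrow> nat \<Rightarrow> real) \<Rightarrow> (nat \<Rightarrow> nat \<Rightarrow> real mat) \<Rightarrow> real mat"
where
  "W_mat n d G a R =
     block_mat n d (\<lambda>i j. if (i, j) \<in> parcs G then a i j \<cdot>\<^sub>m R i j else 0\<^sub>m d d)"

definition L_dir ::
  "nat \<Rightarrow> nat \<Rightarrow> nat pair_pre_digraph \<Rightarrow> (nat \<Rightarrow> nat \<Rightarrow> real) \<Rightarrow> (nat \<Rightarrow> nat \<Rightarrow> real mat) \<Rightarrow> real mat"
where
  "L_dir n d G a R =
     kronecker_mat (row_sum_mat (adjacency_mat n G a)) (1\<^sub>m d) - W_mat n d G a R"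

definition P_mat :: "nat \<Rightarrow> nat pair_pre_digraph \<Rightarrow> (nat \<Rightarrow> nat \<Rightarrow> real) \<Rightarrow> real mat" where
  "P_mat n G a = row_sum_mat (adjacency_mat n G a) + adjacency_mat n G a"

definition vec_norm2 :: "real vec \<Rightarrow> real" where
  "vec_norm2 v = L2_set (\<lambda>i. v $ i) {0..<dim_vec v}"

definition spectral_norm :: "real mat \<Rightarrow> real" where
  "spectral_norm A = (SUP v\<in>{v \<in> carrier_vec (dim_col A). vec_norm2 v \<le> 1}. vec_norm2 (A *\<^sub>v v))"

text \<open>Eigenvalues and Jordan blocks of a real matrix are taken over the complex numbers.\<close>

abbreviation cmat :: "real mat \<Rightarrow> complex mat" where
  "cmat A \<equiv> map_mat complex_of_real A"

text \<open>
  This is a property of the system \<open>x' = M x\<close>. Over the complex numbers a Jordan normal form exists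
  and is unique up to the order of its blocks, so the choice of \<open>blocks\<close> is immaterial.
\<close>

definition critically_stable :: "real mat \<Rightarrow> bool" where
  "critically_stable M \<longleftrightarrow>
     (\<forall>z. eigenvalue (cmat M) z \<longrightarrow> Re z \<le> 0) \<and>
     (\<exists>blocks. jordan_nf (cmat M) blocks \<and> (\<forall>(k, z)\<in>set blocks. Re z = 0 \<longrightarrow> k \<le> 1))"

definition purely_imaginary :: "complex \<Rightarrow> bool" where
  "purely_imaginary z \<longleftrightarrow> z \<noteq> 0 \<and> Re z = 0"

definition algebraic_multiplicity :: "complex mat \<Rightarrow> complex \<Rightarrow> nat" where
  "algebraic_multiplicity M z = Polynomial.order z (char_poly M)"

definition geometric_multiplicity :: "complex mat \<Rightarrow> complex \<Rightarrow> nat" where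
  "geometric_multiplicity M z = kernel_dim (char_matrix M z)"

end

theory Submission
  imports Defs
begin

text \<open>
  Measure a vector of \<open>\<complex>\<^bsup>nd\<^esup>\<close> by the largest Euclidean norm of its \<open>n\<close> blocks. Orthogonal matrices
  preserve Euclidean norms, so \<open>I - t L\<close> is a contraction for this norm as soon as \<open>t\<close> times every
  row sum is at most \<open>1\<close>: its \<open>i\<close>-th block row is a convex combination of isometries. Hence
  \<open>\<bar>1 - t z\<bar> \<le> 1\<close> for each eigenvalue \<open>z\<close> of \<open>L\<close>, a disc that meets the imaginary axis only at \<open>0\<close>.
  For \<open>0 < s < t\<close> the disc \<open>\<bar>1 - s z\<bar> \<le> 1\<close> is strictly larger except at its boundary point \<open>0\<close>, so
  \<open>\<bar>1 - s z\<bar> = 1\<close> forces \<open>z = 0\<close>.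
  If \<open>L v = w\<close> and \<open>L w = 0\<close>, then \<open>(I - t L)\<^sup>k v = v - k t w\<close> stays bounded, so \<open>w = 0\<close>; thus \<open>0\<close> is
  a semisimple eigenvalue. For the spectral norm, the blocks of \<open>L x\<close> have norms dominated by the
  entries of \<open>P y\<close>, where \<open>y\<close> collects the block norms of \<open>x\<close>.
\<close>

section \<open>Semisimple eigenvalues\<close>

text \<open>The hypothesis says that \<open>char_matrix A z\<close> and its square have the same
  kernel, and \<open>dim_gen_eigenspace\<close> is the dimension of the kernel of a power.\<close>

lemma dim_gen_eigenspace_2_eq_1:
  fixes A :: "complex mat"
  assumes A: "A \<in> carrier_mat n n"
    and ss: "\<And>v. v \<in> carrier_vec n \<Longrightarrow>
      char_matrix A z *\<^sub>v (char_matrix A z *\<^sub>v v) = 0\<^sub>v n \<Longrightarrow> char_matrix A z *\<^sub>v v = 0\<^sub>v n"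
  shows "dim_gen_eigenspace A z 2 = dim_gen_eigenspace A z 1"
proof -
  let ?B = "char_matrix A z"
  have B: "?B \<in> carrier_mat n n" using A by simp
  have sq: "?B ^\<^sub>m 2 = ?B * ?B" using B by (simp add: numeral_2_eq_2)
  have B2: "?B ^\<^sub>m 2 \<in> carrier_mat n n" using B by (rule pow_carrier_mat)
  have "mat_kernel (?B ^\<^sub>m 2) = mat_kernel ?B"
  proof (intro equalityI subsetI)
    fix v assume "v \<in> mat_kernel (?B ^\<^sub>m 2)"
    then have v: "v \<in> carrier_vec n" and "(?B * ?B) *\<^sub>v v = 0\<^sub>v n"
      using mat_kernelD[OF B2] sq by auto
    then have "?B *\<^sub>v (?B *\<^sub>v v) = 0\<^sub>v n" using B by simp
    then show "v \<in> mat_kernel ?B" using ss v by (intro mat_kernelI[OF B]) auto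
  next
    fix v assume "v \<in> mat_kernel ?B"
    from mat_kernelD[OF B this] have v: "v \<in> carrier_vec n" and "?B *\<^sub>v v = 0\<^sub>v n" by auto
    moreover have "?B *\<^sub>v 0\<^sub>v n = 0\<^sub>v n" using B by auto
    ultimately have "(?B * ?B) *\<^sub>v v = 0\<^sub>v n" using B by simp
    then show "v \<in> mat_kernel (?B ^\<^sub>m 2)" using v sq by (intro mat_kernelI[OF B2]) auto
  qed
  moreover have "?B ^\<^sub>m 1 = ?B" using B by simp
  moreover have "dim_col (?B ^\<^sub>m 2) = n" "dim_col ?B = n" using B B2 by auto
  ultimately show ?thesis by (simp add: dim_gen_eigenspace_def kernel_dim_def)
qed

text \<open>Termwise \<open>min 1 m\<close> is at most \<open>min 2 m\<close>, strictly so for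
  \<open>m\<close> at least 2; a single large entry would therefore separate the two sums.\<close>

lemma sum_list_min_2_eq_min_1:
  assumes "(\<Sum>n\<leftarrow>ns. min 2 n) = (\<Sum>n\<leftarrow>ns. min 1 n)" and "(k::nat) \<in> set ns"
  shows "k \<le> 1"
  using assms
proof (induction ns)
  case (Cons m ns)
  have "(\<Sum>n\<leftarrow>ns. min 1 n) \<le> (\<Sum>n\<leftarrow>ns. min 2 n)" by (rule sum_list_mono) auto
  with Cons show ?case by (auto simp: min_def split: if_splits)
qed simp

text \<open>The kernel of the \<open>k\<close>-th power of \<open>char_matrix A z\<close> has
  dimension equal to the sum of \<open>min k m\<close> over the sizes \<open>m\<close> of the blocks
  for \<open>z\<close>. Comparing \<open>k = 1\<close> with \<open>k = 2\<close> detects any block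
  of size at least 2.\<close>

lemma jordan_block_size_semisimple:
  fixes A :: "complex mat"
  assumes A: "A \<in> carrier_mat n n"
    and ss: "\<And>v. v \<in> carrier_vec n \<Longrightarrow>
      char_matrix A z *\<^sub>v (char_matrix A z *\<^sub>v v) = 0\<^sub>v n \<Longrightarrow> char_matrix A z *\<^sub>v v = 0\<^sub>v n"
    and jnf: "jordan_nf A blocks" and k: "(k, z) \<in> set blocks"
  shows "k \<le> 1"
proof -
  let ?ns = "map fst [(n, e)\<leftarrow>blocks. e = z]"
  have "(\<Sum>n\<leftarrow>?ns. min 2 n) = (\<Sum>n\<leftarrow>?ns. min 1 n)"
    using dim_gen_eigenspace_2_eq_1[OF A ss] unfolding dim_gen_eigenspace[OF jnf] .
  moreover have "k \<in> set ?ns" using k by force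
  ultimately show ?thesis by (rule sum_list_min_2_eq_min_1)
qed

lemma jordan_nf_complex_exists:
  fixes A :: "complex mat"
  assumes "A \<in> carrier_mat n n"
  obtains blocks where "jordan_nf A blocks"
  using char_poly_factorized[OF assms] jordan_nf_exists[OF assms] by metis

text \<open>The geometric multiplicity counts the Jordan blocks for \<open>z\<close>, the algebraic
  one adds up their sizes; sizes of at most one make these equal.\<close>

lemma multiplicities_eq_semisimple:
  fixes A :: "complex mat"
  assumes A: "A \<in> carrier_mat n n"
    and ss: "\<And>v. v \<in> carrier_vec n \<Longrightarrow>
      char_matrix A z *\<^sub>v (char_matrix A z *\<^sub>v v) = 0\<^sub>v n \<Longrightarrow> char_matrix A z *\<^sub>v v = 0\<^sub>v n"
  shows "algebraic_multiplicity A z = geometric_multiplicity A z"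
proof -
  obtain blocks where jnf: "jordan_nf A blocks" using jordan_nf_complex_exists[OF A] .
  let ?ns = "map fst [(n, e)\<leftarrow>blocks. e = z]"
  have le: "k \<le> 1" if "k \<in> set ?ns" for k
    using that jordan_block_size_semisimple[OF A ss jnf] by auto
  have "geometric_multiplicity A z = dim_gen_eigenspace A z 1"
    using A by (simp add: geometric_multiplicity_def dim_gen_eigenspace_def)
  also have "\<dots> = (\<Sum>n\<leftarrow>?ns. min 1 n)" by (rule dim_gen_eigenspace[OF jnf])
  \<comment> \<open>On sizes of at most one, \<open>min 1\<close> is the identity.\<close>
  also have "\<dots> = sum_list ?ns" using le by (intro arg_cong[of _ _ sum_list] map_idI) auto
  also have "\<dots> = algebraic_multiplicity A z"
    unfolding algebraic_multiplicity_def jordan_nf_order[OF jnf]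
    by (intro arg_cong[of _ _ sum_list] arg_cong[of _ _ "map fst"] filter_cong) auto
  finally show ?thesis by simp
qed

section \<open>Contractions for a norm\<close>

text \<open>Vectors of a given dimension form a carrier set rather than a type, so the norm axioms
  other than nonnegativity are stated relative to that set.\<close>

locale complex_vec_norm =
  fixes N :: nat and p :: "complex vec \<Rightarrow> real"
  assumes nonneg: "0 \<le> p v"
    and triangle: "u \<in> carrier_vec N \<Longrightarrow> v \<in> carrier_vec N \<Longrightarrow> p (u + v) \<le> p u + p v"
    and scale: "v \<in> carrier_vec N \<Longrightarrow> p (c \<cdot>\<^sub>v v) = cmod c * p v"
    and definite: "v \<in> carrier_vec N \<Longrightarrow> p v = 0 \<Longrightarrow> v = 0\<^sub>v N"
begin

text \<open>An eigenvector of \<open>A\<close> for \<open>z\<close> is one of \<open>I - t A\<close>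
  for \<open>1 - t * z\<close>, and its norm is positive, so it can be cancelled.\<close>

lemma contraction_eigenvalue:
  assumes A: "A \<in> carrier_mat N N"
    and contr: "\<And>v. v \<in> carrier_vec N \<Longrightarrow> p (v - t \<cdot>\<^sub>v (A *\<^sub>v v)) \<le> p v"
    and ev: "eigenvalue A z"
  shows "cmod (1 - t * z) \<le> 1"
proof -
  from ev A obtain v where v: "v \<in> carrier_vec N" "v \<noteq> 0\<^sub>v N" and Av: "A *\<^sub>v v = z \<cdot>\<^sub>v v"
    unfolding eigenvalue_def eigenvector_def by auto
  have "v - t \<cdot>\<^sub>v (A *\<^sub>v v) = (1 - t * z) \<cdot>\<^sub>v v"
    unfolding Av using v(1) by (intro eq_vecI) (auto simp: algebra_simps)
  with contr[OF v(1)] scale[OF v(1)] have "cmod (1 - t * z) * p v \<le> 1 * p v" by simp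
  moreover have "p v > 0" using nonneg[of v] definite[OF v(1)] v(2) by force
  ultimately show ?thesis by (simp only: mult_le_cancel_right_pos)
qed

lemma contraction_kernel_square:
  assumes A: "A \<in> carrier_mat N N" and t: "t \<noteq> 0"
    and contr: "\<And>v. v \<in> carrier_vec N \<Longrightarrow> p (v - t \<cdot>\<^sub>v (A *\<^sub>v v)) \<le> p v"
    and v: "v \<in> carrier_vec N" and AA: "A *\<^sub>v (A *\<^sub>v v) = 0\<^sub>v N"
  shows "A *\<^sub>v v = 0\<^sub>v N"
proof -
  define w where "w = A *\<^sub>v v"
  have w: "w \<in> carrier_vec N" using A v by (auto simp: w_def)
  \<comment> \<open>The vector is the \<open>k\<close>-th iterate of the contraction at
    \<open>v\<close>: since \<open>A w = 0\<close>, every iteration subtracts the same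
    \<open>t w\<close>.\<close>
  have bdd: "p (v - (of_nat k * t) \<cdot>\<^sub>v w) \<le> p v" for k
  proof (induction k)
    case 0
    have "v - (of_nat 0 * t) \<cdot>\<^sub>v w = v" using v w by auto
    then show ?case by simp
  next
    case (Suc k)
    let ?u = "v - (of_nat k * t) \<cdot>\<^sub>v w"
    have u: "?u \<in> carrier_vec N" using v w by auto
    have "A *\<^sub>v ?u = w - (of_nat k * t) \<cdot>\<^sub>v (A *\<^sub>v w)"
      using A v w by (simp add: mult_minus_distrib_mat_vec mult_mat_vec w_def)
    also have "A *\<^sub>v w = 0\<^sub>v N" using AA by (simp add: w_def)
    also have "w - (of_nat k * t) \<cdot>\<^sub>v 0\<^sub>v N = w" using w by (intro eq_vecI) auto
    finally have Au: "A *\<^sub>v ?u = w" .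
    have "?u - t \<cdot>\<^sub>v (A *\<^sub>v ?u) = v - (of_nat (Suc k) * t) \<cdot>\<^sub>v w"
      unfolding Au using v w by (intro eq_vecI) (auto simp: algebra_simps)
    with contr[OF u] Suc.IH show ?case by simp
  qed
  have "real k * (cmod t * p w) \<le> 2 * p v" for k
  proof -
    let ?u = "v - (of_nat k * t) \<cdot>\<^sub>v w"
    have u: "?u \<in> carrier_vec N" using v w by auto
    \<comment> \<open>The multiple of \<open>w\<close> is a difference of two vectors of norm at
      most \<open>p v\<close>. It is written as a sum with a \<open>-1\<close> multiple so that
      \<open>triangle\<close> and \<open>scale\<close> apply.\<close>
    have "(of_nat k * t) \<cdot>\<^sub>v w = v + (-1) \<cdot>\<^sub>v ?u" using v w by (intro eq_vecI) auto
    then have "real k * (cmod t * p w) = p (v + (-1) \<cdot>\<^sub>v ?u)"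
      using scale[OF w, of "of_nat k * t"] by (simp add: norm_mult)
    also have "\<dots> \<le> p v + p ?u" using triangle[OF v, of "(-1) \<cdot>\<^sub>v ?u"] scale[OF u, of "-1"] u by simp
    also have "\<dots> \<le> 2 * p v" using bdd[of k] by simp
    finally show ?thesis .
  qed
  \<comment> \<open>A positive value would have unbounded multiples, by the Archimedean
    property.\<close>
  then have "\<not> 0 < cmod t * p w"
    using reals_Archimedean3[of "cmod t * p w"] by (meson not_less)
  then have "p w = 0" using t nonneg[of w] by (auto simp: zero_less_mult_iff)
  with definite[OF w] show ?thesis by (simp add: w_def)
qed

end

section \<open>Norms of blocks\<close>

text \<open>Complex entries are needed for eigenvectors; real vectors are embedded when the same
  estimates serve the spectral norm.\<close>

definition block_norm :: "nat \<Rightarrow> complex vec \<Rightarrow> nat \<Rightarrow> real" where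
  "block_norm d v i = L2_set (\<lambda>k. cmod (v $ (i * d + k))) {..<d}"

text \<open>Inserting \<open>0\<close> covers \<open>n = 0\<close>, where \<^const>\<open>Max\<close> of the empty set is unspecified.\<close>

definition max_block_norm :: "nat \<Rightarrow> nat \<Rightarrow> complex vec \<Rightarrow> real" where
  "max_block_norm n d v = Max (insert 0 (block_norm d v ` {..<n}))"

lemma block_index_less:
  fixes n d :: nat
  assumes "i < n" and "k < d"
  shows "i * d + k < n * d"
proof -
  have "i * d + k < Suc i * d" using assms by simp
  also have "\<dots> \<le> n * d" using assms by (intro mult_right_mono) auto
  finally show ?thesis .
qed

lemma block_norm_nonneg [simp]: "0 \<le> block_norm d v i"
  by (simp add: block_norm_def)

lemma block_norm_le_max: "i < n \<Longrightarrow> block_norm d v i \<le> max_block_norm n d v"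
  unfolding max_block_norm_def by (intro Max_ge) auto

lemma max_block_norm_nonneg: "0 \<le> max_block_norm n d v"
  unfolding max_block_norm_def by (intro Max_ge) auto

lemma max_block_norm_leI:
  assumes "0 \<le> B" and "\<And>i. i < n \<Longrightarrow> block_norm d v i \<le> B"
  shows "max_block_norm n d v \<le> B"
  using assms unfolding max_block_norm_def by (subst Max_le_iff) auto

lemma L2_set_cmod_add_le:
  "L2_set (\<lambda>k. cmod (f k + g k)) K \<le> L2_set (\<lambda>k. cmod (f k)) K + L2_set (\<lambda>k. cmod (g k)) K"
proof -
  have "L2_set (\<lambda>k. cmod (f k + g k)) K \<le> L2_set (\<lambda>k. cmod (f k) + cmod (g k)) K"
    by (intro L2_set_mono norm_triangle_ineq) auto
  also note L2_set_triangle_ineq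
  finally show ?thesis .
qed

lemma L2_set_cmod_sum_le:
  assumes "finite J"
  shows "L2_set (\<lambda>k. cmod (\<Sum>j\<in>J. f j k)) K \<le> (\<Sum>j\<in>J. L2_set (\<lambda>k. cmod (f j k)) K)"
  using assms
proof (induction J)
  case empty
  then show ?case by (simp add: L2_set_0')
next
  case (insert j J)
  then show ?case
    using L2_set_cmod_add_le[of "f j" "\<lambda>k. \<Sum>j\<in>J. f j k" K] by simp
qed

lemma L2_set_cmod_mult: "L2_set (\<lambda>k. cmod (c * f k)) K = cmod c * L2_set (\<lambda>k. cmod (f k)) K"
  by (simp add: norm_mult L2_set_right_distrib)

lemma complex_vec_norm_max_block_norm: "complex_vec_norm (n * d) (max_block_norm n d)"
proof
  show "0 \<le> max_block_norm n d v" for v by (rule max_block_norm_nonneg)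
next
  fix u v :: "complex vec"
  assume uv: "u \<in> carrier_vec (n * d)" "v \<in> carrier_vec (n * d)"
  show "max_block_norm n d (u + v) \<le> max_block_norm n d u + max_block_norm n d v"
  proof (rule max_block_norm_leI)
    fix i assume i: "i < n"
    have "block_norm d (u + v) i = L2_set (\<lambda>k. cmod (u $ (i * d + k) + v $ (i * d + k))) {..<d}"
      unfolding block_norm_def using uv i block_index_less by (intro L2_set_cong) auto
    also have "\<dots> \<le> block_norm d u i + block_norm d v i"
      unfolding block_norm_def by (rule L2_set_cmod_add_le)
    also have "\<dots> \<le> max_block_norm n d u + max_block_norm n d v"
      using i by (intro add_mono block_norm_le_max)
    finally show "block_norm d (u + v) i \<le> \<dots>" .
  qed (simp add: max_block_norm_nonneg)
next
  fix v :: "complex vec" and c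
  assume v: "v \<in> carrier_vec (n * d)"
  have eq: "block_norm d (c \<cdot>\<^sub>v v) i = cmod c * block_norm d v i" if "i < n" for i
  proof -
    have "block_norm d (c \<cdot>\<^sub>v v) i = L2_set (\<lambda>k. cmod (c * v $ (i * d + k))) {..<d}"
      unfolding block_norm_def using v that block_index_less by (intro L2_set_cong) auto
    then show ?thesis by (simp add: block_norm_def L2_set_cmod_mult)
  qed
  \<comment> \<open>The inserted \<open>0\<close> is fixed by scaling, so the new set is an image of
    the old one. Scaling by a nonnegative factor is monotone and commutes with
    \<open>Max\<close>.\<close>
  have "max_block_norm n d (c \<cdot>\<^sub>v v) = Max ((\<lambda>r. cmod c * r) ` insert 0 (block_norm d v ` {..<n}))"
    unfolding max_block_norm_def by (rule arg_cong[of _ _ Max]) (auto simp: eq image_iff)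
  also have "\<dots> = cmod c * max_block_norm n d v"
    unfolding max_block_norm_def
    by (rule mono_Max_commute[symmetric]) (auto intro!: monoI mult_left_mono)
  finally show "max_block_norm n d (c \<cdot>\<^sub>v v) = cmod c * max_block_norm n d v" .
next
  fix v :: "complex vec"
  assume v: "v \<in> carrier_vec (n * d)" and 0: "max_block_norm n d v = 0"
  show "v = 0\<^sub>v (n * d)"
  proof (intro eq_vecI)
    fix r assume "r < dim_vec (0\<^sub>v (n * d) :: complex vec)"
    then have r: "r < n * d" by simp
    \<comment> \<open>An index below \<open>n * d\<close> rules out \<open>d = 0\<close>; this gives
      \<open>r mod d < d\<close> below.\<close>
    then have d: "0 < d" by (cases d) auto
    have i: "r div d < n" using r by (simp add: less_mult_imp_div_less)
    have "block_norm d v (r div d) = 0"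
      using block_norm_le_max[OF i, of d v] 0 by (simp add: order_antisym)
    then have "\<forall>k\<in>{..<d}. v $ (r div d * d + k) = 0"
      by (simp add: block_norm_def L2_set_eq_0_iff)
    from bspec[OF this, of "r mod d"] d show "v $ r = 0\<^sub>v (n * d) $ r" using r by simp
  qed (use v in simp)
qed

text \<open>A real orthogonal matrix is also unitary on complex vectors. Expanding the squared norm
  gives a triple sum; summing over the row index first leaves only the diagonal terms, as the
  columns are orthonormal.\<close>

lemma orthogonal_group_isometry:
  assumes "Q \<in> orthogonal_group d"
  shows "L2_set (\<lambda>k. cmod (\<Sum>l<d. of_real (Q $$ (k, l)) * x l)) {..<d} = L2_set (\<lambda>l. cmod (x l)) {..<d}"
proof -
  from assms have Q: "Q \<in> carrier_mat d d" and QQ: "transpose_mat Q * Q = 1\<^sub>m d"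
    by (auto simp: orthogonal_group_def)
  have orth: "(\<Sum>k<d. Q $$ (k, l) * Q $$ (k, m)) = (if l = m then 1 else 0)" if "l < d" "m < d" for l m
  proof -
    have "(transpose_mat Q * Q) $$ (l, m) = (\<Sum>k<d. Q $$ (k, l) * Q $$ (k, m))"
      using Q that by (simp add: scalar_prod_def lessThan_atLeast0)
    then show ?thesis using that by (simp add: QQ)
  qed
  have "complex_of_real (\<Sum>k<d. (cmod (\<Sum>l<d. of_real (Q $$ (k, l)) * x l))\<^sup>2)
      = (\<Sum>k<d. (\<Sum>l<d. of_real (Q $$ (k, l)) * x l) * cnj (\<Sum>m<d. of_real (Q $$ (k, m)) * x m))"
    by (simp only: of_real_sum complex_norm_square)
  also have "\<dots> = (\<Sum>k<d. \<Sum>l<d. \<Sum>m<d. of_real (Q $$ (k, l) * Q $$ (k, m)) * (x l * cnj (x m)))"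
    by (simp add: sum_product mult_ac)
  also have "\<dots> = (\<Sum>l<d. \<Sum>k<d. \<Sum>m<d. of_real (Q $$ (k, l) * Q $$ (k, m)) * (x l * cnj (x m)))"
    by (rule sum.swap)
  also have "\<dots> = (\<Sum>l<d. \<Sum>m<d. \<Sum>k<d. of_real (Q $$ (k, l) * Q $$ (k, m)) * (x l * cnj (x m)))"
    by (intro sum.cong refl sum.swap)
  also have "\<dots> = (\<Sum>l<d. \<Sum>m<d. of_real (\<Sum>k<d. Q $$ (k, l) * Q $$ (k, m)) * (x l * cnj (x m)))"
    by (simp only: of_real_sum sum_distrib_right)
  also have "\<dots> = (\<Sum>l<d. \<Sum>m<d. if l = m then x l * cnj (x m) else 0)"
    by (intro sum.cong refl) (simp add: orth)
  also have "\<dots> = (\<Sum>l<d. x l * cnj (x l))" by simp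
  also have "\<dots> = complex_of_real (\<Sum>l<d. (cmod (x l))\<^sup>2)"
    by (simp only: of_real_sum complex_norm_square)
  finally have "(\<Sum>k<d. (cmod (\<Sum>l<d. of_real (Q $$ (k, l)) * x l))\<^sup>2) = (\<Sum>l<d. (cmod (x l))\<^sup>2)"
    by (simp only: of_real_eq_iff)
  then show ?thesis by (simp add: L2_set_def)
qed

section \<open>The connection Laplacian acting on blocks\<close>

text \<open>Extension by \<open>0\<close> off the arcs lets sums over out-neighbours run over all
  \<open>j < n\<close>.\<close>

definition weight :: "nat pair_pre_digraph \<Rightarrow> (nat \<Rightarrow> nat \<Rightarrow> real) \<Rightarrow> nat \<Rightarrow> nat \<Rightarrow> real" where
  "weight G a i j = (if (i, j) \<in> parcs G then a i j else 0)"

lemma adjacency_mat_carrier: "adjacency_mat n G a \<in> carrier_mat n n"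
  by (simp add: adjacency_mat_def)

lemma row_sum_adjacency_mat:
  "row_sum_mat (adjacency_mat n G a) = mat_diag n (\<lambda>i. \<Sum>j<n. weight G a i j)"
  unfolding row_sum_mat_def mat_diag_def
  by (intro eq_matI)
    (auto simp: adjacency_mat_def scalar_prod_def weight_def lessThan_atLeast0 intro!: sum.cong)

lemma P_mat_mult_index:
  assumes "y \<in> carrier_vec n" and "i < n"
  shows "(P_mat n G a *\<^sub>v y) $ i = (\<Sum>j<n. weight G a i j) * y $ i + (\<Sum>j<n. weight G a i j * y $ j)"
proof -
  have "(P_mat n G a *\<^sub>v y) $ i
      = (\<Sum>j<n. ((if i = j then \<Sum>j<n. weight G a i j else 0) + weight G a i j) * y $ j)"
    using assms unfolding P_mat_def row_sum_adjacency_mat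
    by (auto simp: scalar_prod_def lessThan_atLeast0 mat_diag_def adjacency_mat_def weight_def
        intro!: sum.cong)
  also have "\<dots> = (\<Sum>j<n. (if i = j then (\<Sum>j<n. weight G a i j) * y $ i else 0) + weight G a i j * y $ j)"
    by (intro sum.cong refl) (simp add: distrib_right)
  finally show ?thesis using assms by (simp add: sum.distrib)
qed

lemma L_dir_carrier [simp]: "L_dir n d G a R \<in> carrier_mat (n * d) (n * d)"
  by (auto simp: L_dir_def W_mat_def block_mat_def)

lemma dim_L_dir [simp]: "dim_row (L_dir n d G a R) = n * d" "dim_col (L_dir n d G a R) = n * d"
  using carrier_matD[OF L_dir_carrier] by auto

text \<open>The dimension of \<open>R i j\<close> is what allows an entry of the scaled block to be
  read off on an arc; off the arcs the factor \<open>weight G a i j\<close> vanishes.\<close>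

lemma L_dir_index:
  assumes "i < n" "j < n" "k < d" "l < d"
    and R: "(i, j) \<in> parcs G \<Longrightarrow> R i j \<in> carrier_mat d d"
  shows "L_dir n d G a R $$ (i * d + k, j * d + l) =
    (if i = j \<and> k = l then (\<Sum>j<n. weight G a i j) else 0) - weight G a i j * R i j $$ (k, l)"
  using assms block_index_less[OF assms(1,3)] block_index_less[OF assms(2,4)]
  unfolding L_dir_def row_sum_adjacency_mat
  by (auto simp: kronecker_mat_def mat_diag_def W_mat_def block_mat_def weight_def)

lemma sum_blocks:
  fixes f :: "nat \<Rightarrow> 'a :: comm_monoid_add"
  shows "(\<Sum>s<n * d. f s) = (\<Sum>j<n. \<Sum>l<d. f (j * d + l))"
proof -
  have "(\<Sum>s = j * d..<j * d + d. f s) = (\<Sum>l<d. f (j * d + l))" for j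
    using sum.shift_bounds_nat_ivl[of f 0 "j * d" d]
    by (simp add: lessThan_atLeast0 add.commute)
  then show ?thesis by (simp flip: sum.nat_group)
qed

lemma L_dir_mult_index:
  assumes v: "v \<in> carrier_vec (n * d)" and i: "i < n" and k: "k < d"
    and R: "\<And>i j. (i, j) \<in> parcs G \<Longrightarrow> R i j \<in> carrier_mat d d"
  shows "(cmat (L_dir n d G a R) *\<^sub>v v) $ (i * d + k) =
    of_real (\<Sum>j<n. weight G a i j) * v $ (i * d + k) -
    (\<Sum>j<n. of_real (weight G a i j) * (\<Sum>l<d. of_real (R i j $$ (k, l)) * v $ (j * d + l)))"
proof -
  let ?deg = "\<Sum>j<n. weight G a i j"
  have r: "i * d + k < n * d" using i k by (rule block_index_less)
  have "(cmat (L_dir n d G a R) *\<^sub>v v) $ (i * d + k)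
      = (\<Sum>s<n * d. of_real (L_dir n d G a R $$ (i * d + k, s)) * v $ s)"
    using v r
    by (auto simp: scalar_prod_def lessThan_atLeast0 intro!: sum.cong)
  also have "\<dots> = (\<Sum>j<n. \<Sum>l<d. of_real (L_dir n d G a R $$ (i * d + k, j * d + l)) * v $ (j * d + l))"
    by (rule sum_blocks)
  \<comment> \<open>The condition is split into nested conditionals so that the inner and the outer
    sum each eliminate one of them.\<close>
  also have "\<dots> = (\<Sum>j<n. \<Sum>l<d. (if i = j then if k = l then of_real ?deg * v $ (j * d + l) else 0 else 0)
      - of_real (weight G a i j) * (of_real (R i j $$ (k, l)) * v $ (j * d + l)))"
  proof (intro sum.cong refl)
    fix j l assume "j \<in> {..<n}" "l \<in> {..<d}"
    then have "j < n" "l < d" by auto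
    from L_dir_index[where G = G and a = a, OF i this(1) k this(2) R]
    show "of_real (L_dir n d G a R $$ (i * d + k, j * d + l)) * v $ (j * d + l) =
      (if i = j then if k = l then of_real ?deg * v $ (j * d + l) else 0 else 0)
      - of_real (weight G a i j) * (of_real (R i j $$ (k, l)) * v $ (j * d + l))"
      by (simp add: left_diff_distrib)
  qed
  also have "\<dots> = (\<Sum>j<n. if i = j then of_real ?deg * v $ (j * d + k) else 0) -
    (\<Sum>j<n. of_real (weight G a i j) * (\<Sum>l<d. of_real (R i j $$ (k, l)) * v $ (j * d + l)))"
    unfolding sum_subtractf[symmetric] sum_distrib_left
    using k by (intro sum.cong refl) (auto simp: sum_subtractf)
  also have "\<dots> = of_real ?deg * v $ (i * d + k) -
    (\<Sum>j<n. of_real (weight G a i j) * (\<Sum>l<d. of_real (R i j $$ (k, l)) * v $ (j * d + l)))"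
    using i by simp
  finally show ?thesis .
qed

section \<open>Euclidean norms by blocks and the spectral norm\<close>

lemma vec_norm2_blocks:
  assumes "x \<in> carrier_vec (n * d)"
  shows "vec_norm2 x = L2_set (block_norm d (map_vec complex_of_real x)) {..<n}"
proof -
  have "(\<Sum>s<n * d. (x $ s)\<^sup>2) = (\<Sum>i<n. \<Sum>k<d. (x $ (i * d + k))\<^sup>2)" by (rule sum_blocks)
  also have "\<dots> = (\<Sum>i<n. (block_norm d (map_vec complex_of_real x) i)\<^sup>2)"
  proof (intro sum.cong refl)
    fix i assume "i \<in> {..<n}"
    then have "block_norm d (map_vec complex_of_real x) i = L2_set (\<lambda>k. \<bar>x $ (i * d + k)\<bar>) {..<d}"
      unfolding block_norm_def using assms block_index_less by (intro L2_set_cong) auto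
    then show "(\<Sum>k<d. (x $ (i * d + k))\<^sup>2) = (block_norm d (map_vec complex_of_real x) i)\<^sup>2"
      by (simp add: L2_set_def sum_nonneg)
  qed
  finally show ?thesis using assms by (simp add: vec_norm2_def L2_set_def lessThan_atLeast0)
qed

text \<open>A real supremum dominates its members only if the set is bounded above. The sum of the
  absolute values of all entries of \<open>A\<close> is a bound, because each entry of a vector in
  the unit ball has absolute value at most 1.\<close>

lemma vec_norm2_le_spectral_norm:
  assumes v: "v \<in> carrier_vec (dim_col A)" "vec_norm2 v \<le> 1"
  shows "vec_norm2 (A *\<^sub>v v) \<le> spectral_norm A"
proof -
  have "vec_norm2 (A *\<^sub>v u) \<le> (\<Sum>i = 0..<dim_row A. \<Sum>j = 0..<dim_col A. \<bar>A $$ (i, j)\<bar>)"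
    if u: "u \<in> carrier_vec (dim_col A)" "vec_norm2 u \<le> 1" for u
  proof -
    have le1: "\<bar>u $ j\<bar> \<le> 1" if "j < dim_col A" for j
    proof -
      have "\<bar>u $ j\<bar> \<le> L2_set (\<lambda>i. \<bar>u $ i\<bar>) {0..<dim_vec u}"
        using u(1) that by (intro member_le_L2_set) auto
      also have "\<dots> = vec_norm2 u" by (simp add: vec_norm2_def L2_set_def)
      finally show ?thesis using u(2) by simp
    qed
    have "vec_norm2 (A *\<^sub>v u) \<le> (\<Sum>i = 0..<dim_row A. \<bar>(A *\<^sub>v u) $ i\<bar>)"
      unfolding vec_norm2_def dim_mult_mat_vec by (rule L2_set_le_sum_abs)
    also have "\<dots> = (\<Sum>i = 0..<dim_row A. \<bar>\<Sum>j = 0..<dim_col A. A $$ (i, j) * u $ j\<bar>)"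
      using u(1) by (intro sum.cong refl) (auto simp: scalar_prod_def)
    also have "\<dots> \<le> (\<Sum>i = 0..<dim_row A. \<Sum>j = 0..<dim_col A. \<bar>A $$ (i, j) * u $ j\<bar>)"
      by (intro sum_mono sum_abs)
    also have "\<dots> \<le> (\<Sum>i = 0..<dim_row A. \<Sum>j = 0..<dim_col A. \<bar>A $$ (i, j)\<bar>)"
      using le1 by (intro sum_mono) (auto simp: abs_mult intro!: mult_left_le)
    finally show ?thesis .
  qed
  then have "bdd_above ((\<lambda>v. vec_norm2 (A *\<^sub>v v)) ` {v \<in> carrier_vec (dim_col A). vec_norm2 v \<le> 1})"
    by (intro bdd_aboveI2) auto
  then show ?thesis unfolding spectral_norm_def using v by (intro cSUP_upper) auto
qed

text \<open>This turns membership in a disc around \<open>1 / t\<close> into a comparison of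
  \<open>Re z\<close> with the squared modulus.\<close>

lemma cmod_one_minus_scaled:
  "(cmod (1 - of_real t * z))\<^sup>2 = 1 - 2 * t * Re z + t\<^sup>2 * (cmod z)\<^sup>2"
  by (simp add: cmod_power2) (simp add: power2_eq_square algebra_simps)

lemma smult_vec_eq_0D:
  fixes v :: "'a :: field vec"
  assumes "v \<in> carrier_vec m" and "c \<noteq> 0" and "c \<cdot>\<^sub>v v = 0\<^sub>v m"
  shows "v = 0\<^sub>v m"
  using assms by (auto simp: vec_eq_iff)

section \<open>Contraction and spectrum for a weighted network\<close>

locale network =
  fixes n d :: nat and \<delta>\<^sub>1 \<delta>\<^sub>2 :: real and G a R
  assumes net: "weighted_network n d \<delta>\<^sub>1 \<delta>\<^sub>2 G a R" and \<delta>\<^sub>1_pos: "\<delta>\<^sub>1 > 0" and \<delta>\<^sub>2_pos: "\<delta>\<^sub>2 > 0"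
begin

abbreviation "L \<equiv> L_dir n d G a R"
abbreviation "deg i \<equiv> \<Sum>j<n. weight G a i j"

lemma R_orth: "(i, j) \<in> parcs G \<Longrightarrow> R i j \<in> orthogonal_group d"
  using net by (auto simp: weighted_network_def)

lemma R_carrier: "(i, j) \<in> parcs G \<Longrightarrow> R i j \<in> carrier_mat d d"
  using R_orth by (auto simp: orthogonal_group_def)

lemma weight_nonneg: "0 \<le> weight G a i j"
  using net \<delta>\<^sub>1_pos by (fastforce simp: weighted_network_def weight_def)

lemma weight_le: "weight G a i j \<le> \<delta>\<^sub>2"
  using net \<delta>\<^sub>2_pos by (auto simp: weighted_network_def weight_def)

lemma deg_nonneg: "0 \<le> deg i"
  by (intro sum_nonneg weight_nonneg)

text \<open>The bound involves only \<open>n\<close> and \<open>\<delta>\<^sub>2\<close>, which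
  makes the admissible step size uniform in \<open>G\<close>, \<open>a\<close> and
  \<open>R\<close>.\<close>

lemma deg_le: "deg i \<le> real n * \<delta>\<^sub>2"
  using sum_bounded_above[of "{..<n}" "weight G a i" \<delta>\<^sub>2] weight_le by simp

text \<open>The triangle inequality is applied to one block row, whose blocks are multiples of
  isometries. The case \<open>s = 1\<close> yields the contraction, while \<open>s = 0\<close>,
  \<open>t = -1\<close> yields the estimate for \<open>L\<close> itself.\<close>

lemma block_norm_affine_L_le:
  assumes v: "v \<in> carrier_vec (n * d)" and i: "i < n"
  shows "block_norm d (s \<cdot>\<^sub>v v - t \<cdot>\<^sub>v (cmat L *\<^sub>v v)) i \<le>
    cmod (s - t * of_real (deg i)) * block_norm d v i + cmod t * (\<Sum>j<n. weight G a i j * block_norm d v j)"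
proof -
  let ?Rv = "\<lambda>j k. \<Sum>l<d. of_real (R i j $$ (k, l)) * v $ (j * d + l)"
  have "block_norm d (s \<cdot>\<^sub>v v - t \<cdot>\<^sub>v (cmat L *\<^sub>v v)) i
      = L2_set (\<lambda>k. cmod ((s - t * of_real (deg i)) * v $ (i * d + k) +
          t * (\<Sum>j<n. of_real (weight G a i j) * ?Rv j k))) {..<d}"
    unfolding block_norm_def
  proof (intro L2_set_cong refl)
    fix k assume "k \<in> {..<d}"
    then have k: "k < d" by simp
    have r: "i * d + k < n * d" using i k by (rule block_index_less)
    have "(s \<cdot>\<^sub>v v - t \<cdot>\<^sub>v (cmat L *\<^sub>v v)) $ (i * d + k) = s * v $ (i * d + k) - t * (cmat L *\<^sub>v v) $ (i * d + k)"
      using r v by (simp del: index_mult_mat_vec)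
    also have "\<dots> = (s - t * of_real (deg i)) * v $ (i * d + k) + t * (\<Sum>j<n. of_real (weight G a i j) * ?Rv j k)"
      by (subst L_dir_mult_index[OF v i k]) (auto intro: R_carrier simp: algebra_simps)
    finally show "cmod ((s \<cdot>\<^sub>v v - t \<cdot>\<^sub>v (cmat L *\<^sub>v v)) $ (i * d + k)) = cmod \<dots>" by simp
  qed
  also have "\<dots> \<le> L2_set (\<lambda>k. cmod ((s - t * of_real (deg i)) * v $ (i * d + k))) {..<d} +
      L2_set (\<lambda>k. cmod (t * (\<Sum>j<n. of_real (weight G a i j) * ?Rv j k))) {..<d}"
    by (rule L2_set_cmod_add_le)
  also have "\<dots> = cmod (s - t * of_real (deg i)) * block_norm d v i +
      cmod t * L2_set (\<lambda>k. cmod (\<Sum>j<n. of_real (weight G a i j) * ?Rv j k)) {..<d}"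
    by (simp only: L2_set_cmod_mult block_norm_def)
  also have "\<dots> \<le> cmod (s - t * of_real (deg i)) * block_norm d v i +
      cmod t * (\<Sum>j<n. L2_set (\<lambda>k. cmod (of_real (weight G a i j) * ?Rv j k)) {..<d})"
    by (intro add_left_mono mult_left_mono L2_set_cmod_sum_le) auto
  \<comment> \<open>On an arc \<open>R i j\<close> preserves the block norm; off the arcs both sides
    vanish with the weight.\<close>
  also have "(\<Sum>j<n. L2_set (\<lambda>k. cmod (of_real (weight G a i j) * ?Rv j k)) {..<d})
      = (\<Sum>j<n. weight G a i j * block_norm d v j)"
  proof (intro sum.cong refl)
    fix j
    show "L2_set (\<lambda>k. cmod (of_real (weight G a i j) * ?Rv j k)) {..<d} = weight G a i j * block_norm d v j"
    proof (cases "(i, j) \<in> parcs G")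
      case True
      then show ?thesis
        using orthogonal_group_isometry[OF R_orth[OF True], of "\<lambda>l. v $ (j * d + l)"] weight_nonneg[of i j]
        by (simp only: L2_set_cmod_mult block_norm_def norm_of_real abs_of_nonneg)
    qed (simp add: weight_def L2_set_0')
  qed
  finally show ?thesis .
qed

lemma L_contraction:
  assumes t: "0 \<le> t" "t * (real n * \<delta>\<^sub>2) \<le> 1" and v: "v \<in> carrier_vec (n * d)"
  shows "max_block_norm n d (v - of_real t \<cdot>\<^sub>v (cmat L *\<^sub>v v)) \<le> max_block_norm n d v"
proof (rule max_block_norm_leI)
  fix i assume i: "i < n"
  let ?M = "max_block_norm n d v"
  \<comment> \<open>The step size makes the diagonal coefficient nonnegative, so its modulus is
    \<open>1 - t * deg i\<close>, and together with the \<open>t * weight G a i j\<close> it sums to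
    1.\<close>
  have "t * deg i \<le> 1" using t(2) mult_left_mono[OF deg_le t(1)] by (rule order_trans[rotated])
  moreover have "1 - complex_of_real t * of_real (deg i) = of_real (1 - t * deg i)" by simp
  ultimately have "cmod (1 - of_real t * of_real (deg i)) = 1 - t * deg i"
    by (simp only: norm_of_real abs_of_nonneg diff_ge_0_iff_ge)
  then have "block_norm d (v - of_real t \<cdot>\<^sub>v (cmat L *\<^sub>v v)) i
      \<le> (1 - t * deg i) * block_norm d v i + t * (\<Sum>j<n. weight G a i j * block_norm d v j)"
    using block_norm_affine_L_le[OF v i, of 1 "of_real t"] t(1) by simp
  also have "\<dots> \<le> (1 - t * deg i) * ?M + t * (\<Sum>j<n. weight G a i j * ?M)"
    using \<open>t * deg i \<le> 1\<close> t(1) i weight_nonneg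
    by (intro add_mono mult_left_mono sum_mono block_norm_le_max) auto
  also have "\<dots> = ?M" by (simp only: sum_distrib_right[symmetric]) (simp add: left_diff_distrib)
  finally show "block_norm d (v - of_real t \<cdot>\<^sub>v (cmat L *\<^sub>v v)) i \<le> ?M" .
qed (rule max_block_norm_nonneg)

lemma L_eigenvalue_disc:
  assumes "0 \<le> t" "t * (real n * \<delta>\<^sub>2) \<le> 1" and "eigenvalue (cmat L) z"
  shows "cmod (1 - of_real t * z) \<le> 1"
proof -
  interpret complex_vec_norm "n * d" "max_block_norm n d" by (rule complex_vec_norm_max_block_norm)
  show ?thesis
    by (rule contraction_eigenvalue[of "cmat L"]) (use assms L_contraction in auto)
qed

text \<open>The \<open>+ 1\<close> keeps the denominator positive for \<open>n = 0\<close>, and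
  \<open>t\<^sub>0\<close> times the degree bound still stays at most 1.\<close>

definition "t\<^sub>0 = 1 / (real n * \<delta>\<^sub>2 + 1)"

lemma t\<^sub>0_pos: "0 < t\<^sub>0"
  using \<delta>\<^sub>2_pos by (simp add: t\<^sub>0_def add_nonneg_pos)

lemma t\<^sub>0_le: "t\<^sub>0 * (real n * \<delta>\<^sub>2) \<le> 1"
  using \<delta>\<^sub>2_pos by (simp add: t\<^sub>0_def divide_simps add_nonneg_pos)

lemma L_kernel_square:
  assumes "v \<in> carrier_vec (n * d)" and "cmat L *\<^sub>v (cmat L *\<^sub>v v) = 0\<^sub>v (n * d)"
  shows "cmat L *\<^sub>v v = 0\<^sub>v (n * d)"
proof -
  interpret complex_vec_norm "n * d" "max_block_norm n d" by (rule complex_vec_norm_max_block_norm)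
  show ?thesis
    by (rule contraction_kernel_square[of "cmat L" "of_real t\<^sub>0"])
      (use assms t\<^sub>0_pos L_contraction[OF _ t\<^sub>0_le] in auto)
qed

text \<open>The disc condition at \<open>t\<^sub>0\<close> is squared and divided by
  \<open>t\<^sub>0\<close>. This form gives nonnegative real parts, excludes nonzero points of the
  imaginary axis, and can be compared with smaller step sizes.\<close>

lemma L_eigenvalue_Re:
  assumes "eigenvalue (cmat L) z"
  shows "t\<^sub>0 * (cmod z)\<^sup>2 \<le> 2 * Re z"
proof -
  have "(cmod (1 - of_real t\<^sub>0 * z))\<^sup>2 \<le> 1\<^sup>2"
    using L_eigenvalue_disc[OF less_imp_le[OF t\<^sub>0_pos] t\<^sub>0_le assms] by (intro power_mono) auto
  then have "t\<^sub>0 * (t\<^sub>0 * (cmod z)\<^sup>2) \<le> t\<^sub>0 * (2 * Re z)"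
    unfolding cmod_one_minus_scaled by (simp add: power2_eq_square algebra_simps)
  then show ?thesis using t\<^sub>0_pos by simp
qed

lemma L_eigenvalue_Re_nonneg: "eigenvalue (cmat L) z \<Longrightarrow> 0 \<le> Re z"
  using L_eigenvalue_Re[of z] t\<^sub>0_pos
  by (smt (verit) mult_nonneg_nonneg zero_le_power2)

lemma L_eigenvalue_Re_0: "eigenvalue (cmat L) z \<Longrightarrow> Re z = 0 \<Longrightarrow> z = 0"
  using L_eigenvalue_Re[of z] t\<^sub>0_pos by (simp add: mult_le_0_iff)

text \<open>Treats \<open>- L\<close> (with \<open>c = 0\<close>, \<open>s = 1\<close>) and
  \<open>I - s L\<close> (with \<open>c = 1\<close>) at once: the eigenvector equation is solved for
  \<open>L v\<close>.\<close>

lemma affine_L_eigenvalue: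
  assumes B: "B \<in> carrier_mat (n * d) (n * d)" and s: "s \<noteq> 0"
    and BL: "\<And>v. v \<in> carrier_vec (n * d) \<Longrightarrow> B *\<^sub>v v = c \<cdot>\<^sub>v v - s \<cdot>\<^sub>v (cmat L *\<^sub>v v)"
    and ev: "eigenvalue B z"
  shows "eigenvalue (cmat L) ((c - z) / s)"
proof -
  from ev B obtain v where v: "v \<in> carrier_vec (n * d)" "v \<noteq> 0\<^sub>v (n * d)" and Bv: "B *\<^sub>v v = z \<cdot>\<^sub>v v"
    unfolding eigenvalue_def eigenvector_def by auto
  have "cmat L *\<^sub>v v = ((c - z) / s) \<cdot>\<^sub>v v"
  proof (rule eq_vecI)
    fix r assume "r < dim_vec (((c - z) / s) \<cdot>\<^sub>v v)"
    then have r: "r < n * d" using v(1) by simp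
    have "(c \<cdot>\<^sub>v v - s \<cdot>\<^sub>v (cmat L *\<^sub>v v)) $ r = (z \<cdot>\<^sub>v v) $ r" using BL[OF v(1)] Bv by simp
    then have "c * v $ r - s * (cmat L *\<^sub>v v) $ r = z * v $ r"
      using r v(1) by (simp del: index_mult_mat_vec)
    then show "(cmat L *\<^sub>v v) $ r = (((c - z) / s) \<cdot>\<^sub>v v) $ r"
      using r v(1) s by (simp add: field_simps del: index_mult_mat_vec)
  qed (use v(1) in simp)
  then show ?thesis using v unfolding eigenvalue_def eigenvector_def by auto
qed

text \<open>The eigenvalue \<open>0\<close> of \<open>L\<close> corresponds to \<open>c\<close> for
  \<open>B\<close>. As \<open>char_matrix B c\<close> acts as \<open>- s L\<close>, its square acts
  as \<open>s * s\<close> times the square of \<open>L\<close>, and the kernel property of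
  \<open>L\<close> carries over.\<close>

lemma affine_L_semisimple:
  assumes B: "B \<in> carrier_mat (n * d) (n * d)" and s: "s \<noteq> 0"
    and BL: "\<And>v. v \<in> carrier_vec (n * d) \<Longrightarrow> B *\<^sub>v v = c \<cdot>\<^sub>v v - s \<cdot>\<^sub>v (cmat L *\<^sub>v v)"
    and v: "v \<in> carrier_vec (n * d)"
    and ker: "char_matrix B c *\<^sub>v (char_matrix B c *\<^sub>v v) = 0\<^sub>v (n * d)"
  shows "char_matrix B c *\<^sub>v v = 0\<^sub>v (n * d)"
proof -
  have char: "char_matrix B c *\<^sub>v u = (- s) \<cdot>\<^sub>v (cmat L *\<^sub>v u)" if u: "u \<in> carrier_vec (n * d)" for u
  proof -
    have "char_matrix B c *\<^sub>v u = B *\<^sub>v u + (- c) \<cdot>\<^sub>v u"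
      unfolding char_matrix_def using B u
      by (subst add_mult_distrib_mat_vec[of _ "n * d" "n * d"]) auto
    also have "\<dots> = (- s) \<cdot>\<^sub>v (cmat L *\<^sub>v u)"
      unfolding BL[OF u] using u by (intro eq_vecI) (auto simp del: index_mult_mat_vec)
    finally show ?thesis .
  qed
  have L: "cmat L \<in> carrier_mat (n * d) (n * d)" by simp
  have Lv: "cmat L *\<^sub>v v \<in> carrier_vec (n * d)" using mult_mat_vec_carrier[OF L v] .
  have "char_matrix B c *\<^sub>v (char_matrix B c *\<^sub>v v) = (s * s) \<cdot>\<^sub>v (cmat L *\<^sub>v (cmat L *\<^sub>v v))"
    using char[OF v] char[of "(- s) \<cdot>\<^sub>v (cmat L *\<^sub>v v)"] Lv mult_mat_vec[OF L Lv]
    by (simp add: smult_smult_assoc)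
  with ker s have "cmat L *\<^sub>v (cmat L *\<^sub>v v) = 0\<^sub>v (n * d)"
    by (intro smult_vec_eq_0D[OF mult_mat_vec_carrier[OF L Lv], of "s * s"]) auto
  from L_kernel_square[OF v this] show ?thesis by (auto simp: char[OF v])
qed

text \<open>The factors \<open>0\<close> and \<open>1\<close> give \<open>- L\<close> the shape
  required by the two affine lemmas.\<close>

lemma uminus_L_mult:
  assumes "v \<in> carrier_vec (n * d)"
  shows "cmat (- L) *\<^sub>v v = 0 \<cdot>\<^sub>v v - 1 \<cdot>\<^sub>v (cmat L *\<^sub>v v)"
proof -
  have "cmat (- L) = - cmat L" by (rule eq_matI) auto
  then show ?thesis using assms by (intro eq_vecI) (auto simp del: index_mult_mat_vec)
qed

lemma one_minus_L_mult:
  assumes v: "v \<in> carrier_vec (n * d)"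
  shows "cmat (1\<^sub>m (n * d) - s \<cdot>\<^sub>m L) *\<^sub>v v = 1 \<cdot>\<^sub>v v - of_real s \<cdot>\<^sub>v (cmat L *\<^sub>v v)"
proof -
  have "cmat (1\<^sub>m (n * d) - s \<cdot>\<^sub>m L) = 1\<^sub>m (n * d) - of_real s \<cdot>\<^sub>m cmat L" by (rule eq_matI) auto
  then have "cmat (1\<^sub>m (n * d) - s \<cdot>\<^sub>m L) *\<^sub>v v = 1\<^sub>m (n * d) *\<^sub>v v - (of_real s \<cdot>\<^sub>m cmat L) *\<^sub>v v"
    using v by (simp add: minus_mult_distrib_mat_vec[of _ "n * d" "n * d"])
  also have "(of_real s \<cdot>\<^sub>m cmat L) *\<^sub>v v = of_real s \<cdot>\<^sub>v (cmat L *\<^sub>v v)"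
    by (rule eq_vecI) (use v in auto)
  finally show ?thesis using v by simp
qed

theorem critically_stable_uminus_L: "critically_stable (- L)"
proof -
  have C: "cmat (- L) \<in> carrier_mat (n * d) (n * d)" by simp
  have ev: "eigenvalue (cmat L) (- z)" if "eigenvalue (cmat (- L)) z" for z
    using affine_L_eigenvalue[OF C one_neq_zero uminus_L_mult that] by simp
  obtain blocks where jnf: "jordan_nf (cmat (- L)) blocks" using jordan_nf_complex_exists[OF C] .
  have "k \<le> 1" if kz: "(k, z) \<in> set blocks" and Re: "Re z = 0" for k z
  proof (cases "k = 0")
    case False
    \<comment> \<open>A nonempty block makes \<open>z\<close> a root of the characteristic
      polynomial, hence an eigenvalue; on the imaginary axis only the semisimple value
      \<open>0\<close> remains.\<close>
    have "k \<le> Polynomial.order z (char_poly (cmat (- L)))"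
      using jnf kz by (rule jordan_nf_block_size_order_bound)
    with False have "Polynomial.order z (char_poly (cmat (- L))) \<noteq> 0" by simp
    then have "poly (char_poly (cmat (- L))) z = 0" unfolding order_root by (rule disjI2)
    then have "eigenvalue (cmat (- L)) z" by (simp add: eigenvalue_root_char_poly[OF C])
    from L_eigenvalue_Re_0[OF ev[OF this]] Re have "z = 0" by simp
    with kz have kz: "(k, 0) \<in> set blocks" by simp
    show ?thesis
      by (rule jordan_block_size_semisimple[OF C affine_L_semisimple[OF C one_neq_zero uminus_L_mult] jnf kz])
  qed simp
  moreover have "Re z \<le> 0" if "eigenvalue (cmat (- L)) z" for z
    using L_eigenvalue_Re_nonneg[OF ev[OF that]] by simp
  ultimately show ?thesis
    unfolding critically_stable_def using jnf by (intro conjI allI impI exI[of _ blocks]) auto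
qed

theorem L_not_purely_imaginary: "eigenvalue (cmat L) z \<Longrightarrow> \<not> purely_imaginary z"
  using L_eigenvalue_Re_0 by (auto simp: purely_imaginary_def)

theorem one_minus_L_eigenvalue:
  assumes s: "0 < s" "s < t\<^sub>0"
    and ev: "eigenvalue (cmat (1\<^sub>m (n * d) - s \<cdot>\<^sub>m L)) z"
  shows "cmod z \<le> 1"
    and "cmod z = 1 \<Longrightarrow> z = 1"
    and "algebraic_multiplicity (cmat (1\<^sub>m (n * d) - s \<cdot>\<^sub>m L)) 1 =
      geometric_multiplicity (cmat (1\<^sub>m (n * d) - s \<cdot>\<^sub>m L)) 1"
proof -
  have C: "cmat (1\<^sub>m (n * d) - s \<cdot>\<^sub>m L) \<in> carrier_mat (n * d) (n * d)" by auto
  have s0: "complex_of_real s \<noteq> 0" using s by simp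
  define y where "y = (1 - z) / of_real s"
  have y: "eigenvalue (cmat L) y"
    using affine_L_eigenvalue[OF C s0 one_minus_L_mult ev] by (simp add: y_def)
  have z: "z = 1 - of_real s * y" using s by (simp add: y_def)
  have "s * (real n * \<delta>\<^sub>2) \<le> t\<^sub>0 * (real n * \<delta>\<^sub>2)" using s \<delta>\<^sub>2_pos by (intro mult_right_mono) auto
  with t\<^sub>0_le have "s * (real n * \<delta>\<^sub>2) \<le> 1" by simp
  from L_eigenvalue_disc[OF _ this y] s show "cmod z \<le> 1" by (simp add: z)
  show "z = 1" if "cmod z = 1"
  proof -
    \<comment> \<open>On the unit circle \<open>2 * Re y\<close> equals \<open>s\<close> times the
      squared modulus of \<open>y\<close>, whereas \<open>L_eigenvalue_Re\<close> bounds it below by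
      \<open>t\<^sub>0\<close> times the same square. Since \<open>s < t\<^sub>0\<close>, this
      leaves \<open>y = 0\<close>.\<close>
    from that have "1 = 1 - 2 * s * Re y + s\<^sup>2 * (cmod y)\<^sup>2"
      unfolding z cmod_one_minus_scaled[symmetric] by simp
    then have "s * (2 * Re y) = s * (s * (cmod y)\<^sup>2)"
      by (auto simp: power2_eq_square)
    then have "2 * Re y = s * (cmod y)\<^sup>2" using s(1) by simp
    with L_eigenvalue_Re[OF y] have "(t\<^sub>0 - s) * (cmod y)\<^sup>2 \<le> 0" by (simp add: left_diff_distrib)
    then have "y = 0" using s(2) by (simp add: mult_le_0_iff)
    then show "z = 1" by (simp add: z)
  qed
  show "algebraic_multiplicity (cmat (1\<^sub>m (n * d) - s \<cdot>\<^sub>m L)) 1 =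
      geometric_multiplicity (cmat (1\<^sub>m (n * d) - s \<cdot>\<^sub>m L)) 1"
    by (rule multiplicities_eq_semisimple[OF C affine_L_semisimple[OF C s0 one_minus_L_mult]])
qed

text \<open>Replacing \<open>x\<close> by its vector \<open>y\<close> of block norms preserves the
  norm, so the unit ball in the supremum for \<open>L\<close> is mapped into the one for
  \<open>P_mat n G a\<close>.\<close>

lemma vec_norm2_L_le:
  fixes x :: "real vec"
  assumes x: "x \<in> carrier_vec (n * d)"
  defines "y \<equiv> vec n (block_norm d (map_vec complex_of_real x))"
  shows "vec_norm2 (L *\<^sub>v x) \<le> vec_norm2 (P_mat n G a *\<^sub>v y)" and "vec_norm2 y = vec_norm2 x"
proof -
  let ?v = "map_vec complex_of_real x"
  have v: "?v \<in> carrier_vec (n * d)" using x by simp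
  have y: "y \<in> carrier_vec n" by (simp add: y_def)
  have Lx: "L *\<^sub>v x \<in> carrier_vec (n * d)" using x by (intro mult_mat_vec_carrier) auto
  show "vec_norm2 y = vec_norm2 x"
    unfolding vec_norm2_blocks[OF x] unfolding vec_norm2_def lessThan_atLeast0
    by (intro L2_set_cong) (auto simp: y_def)
  have hom: "map_vec complex_of_real (L *\<^sub>v x) = cmat L *\<^sub>v ?v"
    by (rule of_real_hom.mult_mat_vec_hom[OF L_dir_carrier x])
  have "vec_norm2 (L *\<^sub>v x) = L2_set (block_norm d (cmat L *\<^sub>v ?v)) {..<n}"
    unfolding vec_norm2_blocks[OF Lx] hom ..
  also have "\<dots> \<le> L2_set (\<lambda>i. (P_mat n G a *\<^sub>v y) $ i) {..<n}"
  proof (intro L2_set_mono)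
    fix i assume "i \<in> {..<n}"
    then have i: "i < n" by simp
    \<comment> \<open>With \<open>s = 0\<close> and \<open>t = -1\<close> the diagonal coefficient
      of the affine estimate has modulus \<open>deg i\<close>, matching the diagonal part of
      \<open>P_mat n G a\<close>.\<close>
    have "cmat L *\<^sub>v ?v = 0 \<cdot>\<^sub>v ?v - (- 1) \<cdot>\<^sub>v (cmat L *\<^sub>v ?v)"
      using v by (intro eq_vecI) (auto simp del: index_mult_mat_vec)
    then have "block_norm d (cmat L *\<^sub>v ?v) i
        \<le> deg i * block_norm d ?v i + (\<Sum>j<n. weight G a i j * block_norm d ?v j)"
      using block_norm_affine_L_le[OF v i, of 0 "- 1"] deg_nonneg[of i]
      by (simp del: of_real_sum)
    also have "\<dots> = (P_mat n G a *\<^sub>v y) $ i"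
      unfolding P_mat_mult_index[OF y i] using i by (simp add: y_def)
    finally show "block_norm d (cmat L *\<^sub>v ?v) i \<le> (P_mat n G a *\<^sub>v y) $ i" .
  qed simp
  also have "\<dots> = vec_norm2 (P_mat n G a *\<^sub>v y)"
    using adjacency_mat_carrier[of n G a] by (simp add: vec_norm2_def lessThan_atLeast0 P_mat_def)
  finally show "vec_norm2 (L *\<^sub>v x) \<le> vec_norm2 (P_mat n G a *\<^sub>v y)" .
qed

theorem spectral_norm_L_le: "spectral_norm L \<le> spectral_norm (P_mat n G a)"
proof -
  have dim: "dim_col (P_mat n G a) = n" by (simp add: P_mat_def adjacency_mat_def)
  show ?thesis
    unfolding spectral_norm_def[of L]
  proof (rule cSUP_least)
    \<comment> \<open>A conditional supremum can be bounded only over a nonempty set; the zero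
      vector is a member, even when \<open>n * d = 0\<close>.\<close>
    have "0\<^sub>v (n * d) \<in> {v \<in> carrier_vec (dim_col L). vec_norm2 v \<le> 1}"
      by (simp add: vec_norm2_def L2_set_0')
    then show "{v \<in> carrier_vec (dim_col L). vec_norm2 v \<le> 1} \<noteq> {}" by blast
  next
    fix x assume "x \<in> {v \<in> carrier_vec (dim_col L). vec_norm2 v \<le> 1}"
    then have x: "x \<in> carrier_vec (n * d)" "vec_norm2 x \<le> 1" by auto
    let ?y = "vec n (block_norm d (map_vec complex_of_real x))"
    have "vec_norm2 (P_mat n G a *\<^sub>v ?y) \<le> spectral_norm (P_mat n G a)"
      by (rule vec_norm2_le_spectral_norm) (use vec_norm2_L_le(2)[OF x(1)] x(2) dim in auto)
    with vec_norm2_L_le(1)[OF x(1)] show "vec_norm2 (L *\<^sub>v x) \<le> spectral_norm (P_mat n G a)" by simp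
  qed
qed

end

theorem proposition21:
  fixes n d :: nat and \<delta>\<^sub>1 \<delta>\<^sub>2 :: real
  assumes "\<delta>\<^sub>1 > 0" and "\<delta>\<^sub>2 > 0"
  shows
    "(\<forall>G a R. weighted_network n d \<delta>\<^sub>1 \<delta>\<^sub>2 G a R \<longrightarrow> quasi_strongly_connected (with_proj G) \<longrightarrow>
        critically_stable (- L_dir n d G a R) \<and>
        spectral_norm (L_dir n d G a R) \<le> spectral_norm (P_mat n G a) \<and>
        (strongly_connected (with_proj G) \<longrightarrow>
           (\<forall>z. eigenvalue (cmat (L_dir n d G a R)) z \<longrightarrow> \<not> purely_imaginary z))) \<and>
     (\<exists>\<epsilon>>0. \<forall>G a R. weighted_network n d \<delta>\<^sub>1 \<delta>\<^sub>2 G a R \<longrightarrow>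
        quasi_strongly_connected (with_proj G) \<longrightarrow> strongly_connected (with_proj G) \<longrightarrow>
        (\<forall>\<epsilon>\<^sub>3\<in>{0<..<\<epsilon>}. \<forall>z.
           eigenvalue (cmat (1\<^sub>m (n * d) - \<epsilon>\<^sub>3 \<cdot>\<^sub>m L_dir n d G a R)) z \<longrightarrow>
           cmod z \<le> 1 \<and>
           (cmod z = 1 \<longrightarrow> z = 1 \<and>
              algebraic_multiplicity (cmat (1\<^sub>m (n * d) - \<epsilon>\<^sub>3 \<cdot>\<^sub>m L_dir n d G a R)) z =
              geometric_multiplicity (cmat (1\<^sub>m (n * d) - \<epsilon>\<^sub>3 \<cdot>\<^sub>m L_dir n d G a R)) z)))"
proof (intro conjI allI impI)
  fix G a R
  assume "weighted_network n d \<delta>\<^sub>1 \<delta>\<^sub>2 G a R"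
  then interpret network n d \<delta>\<^sub>1 \<delta>\<^sub>2 G a R using assms by unfold_locales
  show "critically_stable (- L)" by (rule critically_stable_uminus_L)
  show "spectral_norm L \<le> spectral_norm (P_mat n G a)" by (rule spectral_norm_L_le)
  show "\<not> purely_imaginary z" if "eigenvalue (cmat L) z" for z
    using that by (rule L_not_purely_imaginary)
next
  show "\<exists>\<epsilon>>0. \<forall>G a R. weighted_network n d \<delta>\<^sub>1 \<delta>\<^sub>2 G a R \<longrightarrow>
        quasi_strongly_connected (with_proj G) \<longrightarrow> strongly_connected (with_proj G) \<longrightarrow>
        (\<forall>\<epsilon>\<^sub>3\<in>{0<..<\<epsilon>}. \<forall>z.
           eigenvalue (cmat (1\<^sub>m (n * d) - \<epsilon>\<^sub>3 \<cdot>\<^sub>m L_dir n d G a R)) z \<longrightarrow>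
           cmod z \<le> 1 \<and>
           (cmod z = 1 \<longrightarrow> z = 1 \<and>
              algebraic_multiplicity (cmat (1\<^sub>m (n * d) - \<epsilon>\<^sub>3 \<cdot>\<^sub>m L_dir n d G a R)) z =
              geometric_multiplicity (cmat (1\<^sub>m (n * d) - \<epsilon>\<^sub>3 \<cdot>\<^sub>m L_dir n d G a R)) z))"
  \<comment> \<open>The witness is \<open>t\<^sub>0\<close> written out, because it has to be fixed
    before the graph, the weights and the matrices.\<close>
  proof (intro exI[of _ "1 / (real n * \<delta>\<^sub>2 + 1)"] conjI allI impI ballI)
    show "0 < 1 / (real n * \<delta>\<^sub>2 + 1)" using assms by (simp add: add_nonneg_pos)
  next
    fix G a R s z
    assume "weighted_network n d \<delta>\<^sub>1 \<delta>\<^sub>2 G a R"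
    then interpret network n d \<delta>\<^sub>1 \<delta>\<^sub>2 G a R using assms by unfold_locales
    assume "s \<in> {0<..<1 / (real n * \<delta>\<^sub>2 + 1)}"
    then have s: "0 < s" "s < t\<^sub>0" by (auto simp: t\<^sub>0_def)
    assume ev: "eigenvalue (cmat (1\<^sub>m (n * d) - s \<cdot>\<^sub>m L)) z"
    show "cmod z \<le> 1" using one_minus_L_eigenvalue(1)[OF s ev] .
    assume "cmod z = 1"
    then show z: "z = 1" by (rule one_minus_L_eigenvalue(2)[OF s ev])
    show "algebraic_multiplicity (cmat (1\<^sub>m (n * d) - s \<cdot>\<^sub>m L)) z =
        geometric_multiplicity (cmat (1\<^sub>m (n * d) - s \<cdot>\<^sub>m L)) z"
      unfolding z using one_minus_L_eigenvalue(3)[OF s ev] .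
  qed
qed

end
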